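(* Let $(T(t))_{t\ge0}$ be a bounded $C_0$-semigroup on a complex Hilbert space $\mathcal{H}$ such that $\omega_0(T)=0$, and let $A$ be its generator. Suppose that $A$ is injective and that, for some integer $k\ge1$ and some function $r:\mathbb{R}_+\to[0,\infty)$ with $\lim_{t\to\infty}r(t)=0$, \[\|T(t)A^{-k}\|_{\mathcal{B}(\mathcal{H})}=O(r(t)),\quad t\to\infty.\] Let $\alpha,\beta:\mathbb{R}_+\to(0,\infty)$ be functions such that \[\lim_{t\to\infty}\alpha(t)=\infty\quad\text{and}\quad\liminf_{t\to\infty}\beta(t)r(t)=0.\] Then \[\mathcal{G}_A(\alpha,\beta):=\{x\in\mathcal{H}:\limsup_{t\to\infty}\alpha(t)\|T(t)x\|_{\mathcal{H}}=\infty\ \text{ and }\ \liminf_{t\to\infty}\beta(t)\|T(t)x\|_{\mathcal{H}}=0\}\] is a dense $G_\delta$ set in $\mathcal{H}$.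
   Context: $\mathbb{R}_+=[0,\infty)$, and $\mathcal{B}(\mathcal{H})$ is the space of bounded linear operators on $\mathcal{H}$ with the operator norm. Bounded means $\sup_{t\ge0}\|T(t)\|_{\mathcal{B}(\mathcal{H})}<\infty$. The exponential growth bound is $\omega_0(T):=\lim_{t\to\infty}\frac{\ln\|T(t)\|_{\mathcal{B}(\mathcal{H})}}{t}$. $A^{-k}$ denotes the inverse of the injective operator $A^k$; the hypothesis $\|T(t)A^{-k}\|_{\mathcal{B}(\mathcal{H})}=O(r(t))$ means that there are $C,t_0>0$ such that $\|T(t)x\|_{\mathcal{H}}\le C\,r(t)\,\|A^kx\|_{\mathcal{H}}$ for all $t\ge t_0$ and all $x$ in the domain $\mathcal{D}(A^k)$. *)

theory Defs
  imports "HOL-Analysis.Analysis"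
begin

text \<open>
  Complex Hilbert spaces, on top of the real Banach spaces of the library. The last axiom makes the
  library norm the one induced by the inner product, and contains its positive definiteness.
\<close>

class complex_hilbert_space = banach +
  fixes scaleC :: "complex \<Rightarrow> 'a \<Rightarrow> 'a"  (infixr "*\<^sub>C" 75)
    and cinner :: "'a \<Rightarrow> 'a \<Rightarrow> complex"
  assumes scaleC_add_right: "c *\<^sub>C (x + y) = c *\<^sub>C x + c *\<^sub>C y"
    and scaleC_add_left: "(c + d) *\<^sub>C x = c *\<^sub>C x + d *\<^sub>C x"
    and scaleC_scaleC: "c *\<^sub>C d *\<^sub>C x = (c * d) *\<^sub>C x"
    and scaleC_of_real: "complex_of_real a *\<^sub>C x = a *\<^sub>R x"
    and cinner_commute: "cinner y x = cnj (cinner x y)"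
    and cinner_add_left: "cinner (x + y) z = cinner x z + cinner y z"
    and cinner_scaleC_left: "cinner (c *\<^sub>C x) y = c * cinner x y"
    and cinner_self: "cinner x x = complex_of_real ((norm x)\<^sup>2)"

instantiation complex :: complex_hilbert_space
begin

definition scaleC_complex :: "complex \<Rightarrow> complex \<Rightarrow> complex" where
  "scaleC_complex c x = c * x"

definition cinner_complex :: "complex \<Rightarrow> complex \<Rightarrow> complex" where
  "cinner_complex x y = x * cnj y"

instance
  by standard
    (auto simp: scaleC_complex_def cinner_complex_def algebra_simps scaleR_conv_of_real
      complex_mult_cnj cmod_power2)

end

text \<open>
  The complex linear elements of the library's bounded (real) linear maps; their operator norm is
  \<^const>\<open>onorm\<close>.
\<close>

definition bounded_clinear :: "('a::complex_hilbert_space \<Rightarrow> 'a) \<Rightarrow> bool" where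
  "bounded_clinear f \<longleftrightarrow> bounded_linear f \<and> (\<forall>c x. f (c *\<^sub>C x) = c *\<^sub>C f x)"

text \<open>
  Functions on the half-line are total functions on \<^typ>\<open>real\<close>; only their values at
  \<open>t \<ge> 0\<close> are constrained and used.
\<close>

definition C0_semigroup :: "(real \<Rightarrow> 'a::complex_hilbert_space \<Rightarrow> 'a) \<Rightarrow> bool" where
  "C0_semigroup T \<longleftrightarrow>
     (\<forall>t\<ge>0. bounded_clinear (T t)) \<and>
     (\<forall>x. T 0 x = x) \<and>
     (\<forall>s\<ge>0. \<forall>t\<ge>0. \<forall>x. T (s + t) x = T s (T t x)) \<and>
     (\<forall>x. continuous_on {0..} (\<lambda>t. T t x))"

definition bounded_semigroup :: "(real \<Rightarrow> 'a::complex_hilbert_space \<Rightarrow> 'a) \<Rightarrow> bool" where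
  "bounded_semigroup T \<longleftrightarrow> bdd_above ((\<lambda>t. onorm (T t)) ` {0..})"

text \<open>
  The logarithm takes the value \<open>-\<infinity>\<close> at \<open>0\<close>, whereas the library has \<open>ln 0 = 0\<close>. Hence nilpotent
  semigroups, and the semigroup on the zero space, have growth bound \<open>-\<infinity>\<close>.
\<close>

definition ereal_ln :: "real \<Rightarrow> ereal" where
  "ereal_ln a = (if a = 0 then -\<infinity> else ereal (ln a))"

definition growth_bound :: "(real \<Rightarrow> 'a::complex_hilbert_space \<Rightarrow> 'a) \<Rightarrow> ereal" where
  "growth_bound T = Lim at_top (\<lambda>t. ereal_ln (onorm (T t)) / ereal t)"

text \<open>
  The generator is an unbounded operator, given by a domain and a function which is meaningful on
  this domain only.
\<close>

definition generator_dom :: "(real \<Rightarrow> 'a::complex_hilbert_space \<Rightarrow> 'a) \<Rightarrow> 'a set" where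
  "generator_dom T = {x. \<exists>y. ((\<lambda>t. (T t x - x) /\<^sub>R t) \<longlongrightarrow> y) (at_right 0)}"

definition generator :: "(real \<Rightarrow> 'a::complex_hilbert_space \<Rightarrow> 'a) \<Rightarrow> 'a \<Rightarrow> 'a" where
  "generator T x = Lim (at_right 0) (\<lambda>t. (T t x - x) /\<^sub>R t)"

text \<open>
  The domain of the \<open>k\<close>-th power of an operator \<open>A\<close> with domain \<open>D\<close>. On this domain the power is
  given by \<open>A ^^ k\<close>.
\<close>

fun power_dom :: "'a set \<Rightarrow> ('a \<Rightarrow> 'a) \<Rightarrow> nat \<Rightarrow> 'a set" where
  "power_dom D A 0 = UNIV"
| "power_dom D A (Suc k) = {x \<in> D. A x \<in> power_dom D A k}"

definition \<G> :: "(real \<Rightarrow> 'a::complex_hilbert_space \<Rightarrow> 'a) \<Rightarrow> (real \<Rightarrow> real) \<Rightarrow> (real \<Rightarrow> real) \<Rightarrow> 'a set"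
  where
  "\<G> T \<alpha> \<beta> =
     {x. Limsup at_top (\<lambda>t. ereal (\<alpha> t * norm (T t x))) = \<infinity> \<and>
         Liminf at_top (\<lambda>t. ereal (\<beta> t * norm (T t x))) = 0}"

end

theory Submission
  imports Defs
begin

text \<open>
  Both defining conditions of the set are countable intersections of open sets
  \<open>U n = {x. \<exists>t\<ge>n. \<alpha> t * norm (T t x) > n}\<close> and
  \<open>V n = {x. \<exists>t\<ge>n. \<beta> t * norm (T t x) < 1 / (n + 1)}\<close>, so by Baire it is enough that each of
  them is dense. The decay hypothesis puts the domain of \<open>A ^ k\<close> inside every \<open>V n\<close>, and this
  domain is dense because averaging an orbit over \<open>[0, h]\<close> raises the regularity by one.
  Subadditivity of \<open>t \<mapsto> ln (onorm (T t))\<close> and growth bound \<open>0\<close> force \<open>onorm (T t) \<ge> 1\<close>, so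
  \<open>\<alpha> t * onorm (T t)\<close> is unbounded and arbitrarily small perturbations of any point lie in
  \<open>U n\<close>.
\<close>

section \<open>Baire category and countable forms of the limit conditions\<close>

lemma complete_space_Baire:
  fixes U :: "nat \<Rightarrow> 'a::complete_space set"
  assumes "\<And>n. open (U n)" "\<And>n. closure (U n) = UNIV"
  shows "closure (\<Inter>n. U n) = UNIV"
proof -
  have "Metric_space.mcomplete (UNIV :: 'a set) dist"
    by (simp add: complete_UNIV)
  from Met_TC.metric_Baire_category[OF this, of "range U"] assms show ?thesis
    by auto
qed

text \<open>A single integer bounds both the time and the value, so the condition becomes a
  countable family of existence statements, as the Baire argument requires. An integer beyond both a
  putative bound and the time from which it holds refutes that bound.\<close>

lemma Limsup_at_top_eq_PInfty_iff:
  fixes f :: "real \<Rightarrow> real"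
  shows "Limsup at_top (\<lambda>t. ereal (f t)) = \<infinity> \<longleftrightarrow> (\<forall>n. \<exists>t\<ge>real n. f t > real n)"
proof
  assume L: "Limsup at_top (\<lambda>t. ereal (f t)) = \<infinity>"
  show "\<forall>n. \<exists>t\<ge>real n. f t > real n"
  proof (rule ccontr)
    assume "\<not> ?thesis"
    then obtain n where n: "\<And>t. t \<ge> real n \<Longrightarrow> f t \<le> real n"
      by (meson not_le)
    have "Limsup at_top (\<lambda>t. ereal (f t)) \<le> ereal (real n)"
      by (rule Limsup_bounded) (auto simp: eventually_at_top_linorder intro!: exI[of _ "real n"] n)
    with L show False
      by simp
  qed
next
  assume R: "\<forall>n. \<exists>t\<ge>real n. f t > real n"
  show "Limsup at_top (\<lambda>t. ereal (f t)) = \<infinity>"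
  proof (rule ccontr)
    assume "\<not> ?thesis"
    then have "Limsup at_top (\<lambda>t. ereal (f t)) < \<infinity>"
      by simp
    then obtain c where "Limsup at_top (\<lambda>t. ereal (f t)) < ereal c"
      using ereal_dense2 by blast
    then have "eventually (\<lambda>t. ereal (f t) < ereal c) at_top"
      by (rule Limsup_lessD)
    then obtain N where N: "\<And>t. t \<ge> N \<Longrightarrow> f t < c"
      by (auto simp: eventually_at_top_linorder)
    obtain n where "real n \<ge> max N c"
      using real_arch_simple by blast
    moreover obtain t where "t \<ge> real n" "f t > real n"
      using R by blast
    ultimately show False
      using N[of t] by simp
  qed
qed

text \<open>Nonnegativity keeps the lower limit at or above \<open>0\<close>. A positive lower limit
  would leave some \<open>c > 0\<close> eventually below \<open>f\<close>, which fails once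
  \<open>1 / (n + 1) \<le> c\<close>.\<close>

lemma Liminf_at_top_eq_0_iff:
  fixes f :: "real \<Rightarrow> real"
  assumes nonneg: "\<And>t. t \<ge> 0 \<Longrightarrow> f t \<ge> 0"
  shows "Liminf at_top (\<lambda>t. ereal (f t)) = 0 \<longleftrightarrow> (\<forall>n. \<exists>t\<ge>real n. f t < 1 / (real n + 1))"
proof
  assume L: "Liminf at_top (\<lambda>t. ereal (f t)) = 0"
  show "\<forall>n. \<exists>t\<ge>real n. f t < 1 / (real n + 1)"
  proof (rule ccontr)
    assume "\<not> ?thesis"
    then obtain n where n: "\<And>t. t \<ge> real n \<Longrightarrow> 1 / (real n + 1) \<le> f t"
      by (meson not_le)
    have "ereal (1 / (real n + 1)) \<le> Liminf at_top (\<lambda>t. ereal (f t))"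
      by (rule Liminf_bounded) (auto simp: eventually_at_top_linorder intro!: exI[of _ "real n"] n)
    with L show False
      by (simp add: field_simps)
  qed
next
  assume R: "\<forall>n. \<exists>t\<ge>real n. f t < 1 / (real n + 1)"
  have "0 \<le> Liminf at_top (\<lambda>t. ereal (f t))"
    by (rule Liminf_bounded) (auto simp: eventually_at_top_linorder intro!: exI[of _ 0] nonneg)
  moreover have "\<not> 0 < Liminf at_top (\<lambda>t. ereal (f t))"
  proof
    assume "0 < Liminf at_top (\<lambda>t. ereal (f t))"
    then obtain c where c: "0 < c" "ereal c < Liminf at_top (\<lambda>t. ereal (f t))"
      using ereal_dense2[of 0] by auto
    then obtain N where N: "\<And>t. t \<ge> N \<Longrightarrow> c < f t"
      using less_LiminfD[OF c(2)] by (auto simp: eventually_at_top_linorder)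
    obtain n where n: "real n \<ge> max N (1 / c)"
      using real_arch_simple by blast
    obtain t where t: "t \<ge> real n" "f t < 1 / (real n + 1)"
      using R by blast
    have "1 / (real n + 1) \<le> c"
      using n c(1) by (simp add: field_simps)
    with t n N[of t] show False
      by simp
  qed
  ultimately show "Liminf at_top (\<lambda>t. ereal (f t)) = 0"
    by simp
qed

subsection \<open>Growth bounds\<close>

text \<open>Exponentiating removes the logarithm and treats \<open>u = 0\<close> uniformly: there
  the quotient is -\<infinity> and both sides hold.\<close>

lemma ereal_ln_divide_less_iff:
  assumes "0 \<le> u" "0 < t"
  shows "ereal_ln u / ereal t < ereal a \<longleftrightarrow> u < exp (a * t)"
proof (cases "u = 0")
  case False
  with assms have "u > 0" by simp
  have "ereal_ln u / ereal t < ereal a \<longleftrightarrow> ln u < a * t"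
    using False assms by (simp add: ereal_ln_def pos_divide_less_eq)
  also have "\<dots> \<longleftrightarrow> u < exp (a * t)"
    using ln_less_cancel_iff[of u "exp (a * t)"] \<open>u > 0\<close> by simp
  finally show ?thesis .
qed (use assms in \<open>simp add: ereal_ln_def divide_ereal_def\<close>)

text \<open>Fekete's lemma for the subadditive function \<open>t \<mapsto> ln (u t)\<close>.\<close>

lemma submultiplicative_growth_tendsto:
  fixes u :: "real \<Rightarrow> real"
  assumes nonneg: "\<And>t. t \<ge> 0 \<Longrightarrow> 0 \<le> u t"
    and mult: "\<And>s t. s \<ge> 0 \<Longrightarrow> t \<ge> 0 \<Longrightarrow> u (s + t) \<le> u s * u t"
    and bound: "\<And>t. t \<ge> 0 \<Longrightarrow> u t \<le> M"
  shows "((\<lambda>t. ereal_ln (u t) / ereal t) \<longlongrightarrow> (INF t\<in>{0<..}. ereal_ln (u t) / ereal t)) at_top"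
    (is "(_ \<longlongrightarrow> ?w) _")
proof (rule order_tendstoI)
  fix a assume a: "a < ?w"
  have "a < ereal_ln (u t) / ereal t" if "t > 0" for t
    using that by (intro less_le_trans[OF a] INF_lower) simp
  then show "eventually (\<lambda>t. a < ereal_ln (u t) / ereal t) at_top"
    by (intro eventually_mono[OF eventually_gt_at_top[of "0::real"]])
next
  fix a assume "?w < a"
  \<comment> \<open>Two reals are interposed: \<open>a1\<close> controls \<open>u\<close> at one
    time \<open>s\<close>, and the gap from \<open>a1\<close> to \<open>a2\<close> later absorbs a
    constant factor.\<close>
  then obtain a2 where a2: "?w < ereal a2" "ereal a2 < a"
    using ereal_dense2 by blast
  then obtain a1 where a1: "?w < ereal a1" "a1 < a2"
    using ereal_dense2[OF a2(1)] by auto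
  then obtain s where s: "s > 0" "ereal_ln (u s) / ereal s < ereal a1"
    by (auto simp: INF_less_iff)
  then have us: "u s < exp (a1 * s)"
    using ereal_ln_divide_less_iff nonneg by simp
  have M: "M \<ge> 0"
    using nonneg[of 0] bound[of 0] by simp
  have pow: "u (real m * s + v) \<le> exp (a1 * s) ^ m * M" if "v \<ge> 0" for m v
  proof (induction m)
    case (Suc m)
    have "u (real (Suc m) * s + v) \<le> u s * u (real m * s + v)"
      using mult[of s "real m * s + v"] s that by (simp add: algebra_simps)
    also have "\<dots> \<le> exp (a1 * s) * (exp (a1 * s) ^ m * M)"
      using Suc us s that by (intro mult_mono) (auto intro: nonneg)
    finally show ?case
      by simp
  qed (use bound that in simp)
  have le: "u t \<le> exp (a1 * t) * (exp (\<bar>a1\<bar> * s) * M)" if "t \<ge> 0" for t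
  proof -
    \<comment> \<open>Division with remainder: \<open>t = m * s + v\<close> with
      \<open>0 \<le> v \<le> s\<close>. Replacing \<open>m * s\<close> by \<open>t\<close> in the
      exponent costs at most \<open>\<bar>a1\<bar> * s\<close>, whichever sign \<open>a1\<close>
      has.\<close>
    define m where "m = nat \<lfloor>t / s\<rfloor>"
    define v where "v = t - real m * s"
    have m: "real m = of_int \<lfloor>t / s\<rfloor>"
      using that s by (simp add: m_def)
    have "real m \<le> t / s" "t / s < real m + 1"
      unfolding m by linarith+
    then have v: "0 \<le> v" "v \<le> s"
      using s by (simp_all add: v_def field_simps)
    have "- (a1 * v) \<le> \<bar>a1\<bar> * s"
      using mult_mono[of "- a1" "\<bar>a1\<bar>" v s] v by simp
    then have "real m * (a1 * s) \<le> a1 * t + \<bar>a1\<bar> * s"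
      by (simp add: v_def algebra_simps)
    then have "exp (a1 * s) ^ m \<le> exp (a1 * t) * exp (\<bar>a1\<bar> * s)"
      by (simp flip: exp_of_nat_mult exp_add)
    then have "exp (a1 * s) ^ m * M \<le> exp (a1 * t) * exp (\<bar>a1\<bar> * s) * M"
      using M by (rule mult_right_mono)
    then show ?thesis
      using pow[OF v(1), of m] by (simp add: v_def mult.assoc)
  qed
  have "filterlim (\<lambda>t. exp ((a2 - a1) * t)) at_top at_top"
    using a1 by (intro filterlim_compose[OF exp_at_top]
        filterlim_tendsto_pos_mult_at_top[OF tendsto_const] filterlim_ident) simp
  then have "eventually (\<lambda>t. exp (\<bar>a1\<bar> * s) * M < exp ((a2 - a1) * t)) at_top"
    by (simp add: filterlim_at_top_dense)
  then show "eventually (\<lambda>t. ereal_ln (u t) / ereal t < a) at_top"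
    using eventually_gt_at_top[of 0]
  proof eventually_elim
    case (elim t)
    then have "exp (a1 * t) * (exp (\<bar>a1\<bar> * s) * M) < exp (a1 * t) * exp ((a2 - a1) * t)"
      by simp
    also have "\<dots> = exp (a2 * t)"
      by (simp flip: exp_add add: algebra_simps)
    finally have "u t < exp (a2 * t)"
      using le[of t] elim by simp
    then have "ereal_ln (u t) / ereal t < ereal a2"
      using ereal_ln_divide_less_iff nonneg elim by simp
    then show ?case
      using a2 by simp
  qed
qed

context
  fixes T :: "real \<Rightarrow> 'h::complex_hilbert_space \<Rightarrow> 'h"
  assumes T: "C0_semigroup T"
begin

lemma semigroup_bounded_linear: "t \<ge> 0 \<Longrightarrow> bounded_linear (T t)"
  using T by (auto simp: C0_semigroup_def bounded_clinear_def)

lemma semigroup_zero: "T 0 x = x"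
  using T by (auto simp: C0_semigroup_def)

lemma semigroup_add: "s \<ge> 0 \<Longrightarrow> t \<ge> 0 \<Longrightarrow> T (s + t) x = T s (T t x)"
  using T by (auto simp: C0_semigroup_def)

lemma semigroup_continuous: "continuous_on {0..} (\<lambda>t. T t x)"
  using T by (auto simp: C0_semigroup_def)

text \<open>By Fekete's lemma the growth bound is the infimum of the quotients over all
  \<open>t > 0\<close>. Being \<open>0\<close>, it excludes negative quotients, hence norms below
  \<open>exp 0\<close>.\<close>

lemma onorm_semigroup_ge_1:
  assumes "bounded_semigroup T" "growth_bound T = 0" "t > 0"
  shows "onorm (T t) \<ge> 1"
proof -
  obtain M where M: "\<And>t. t \<ge> 0 \<Longrightarrow> onorm (T t) \<le> M"
    using assms(1) by (auto simp: bounded_semigroup_def bdd_above_def)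
  have "((\<lambda>t. ereal_ln (onorm (T t)) / ereal t) \<longlongrightarrow>
      (INF t\<in>{0<..}. ereal_ln (onorm (T t)) / ereal t)) at_top"
  proof (rule submultiplicative_growth_tendsto)
    fix s t :: real assume st: "s \<ge> 0" "t \<ge> 0"
    then have "T (s + t) = T s \<circ> T t"
      by (auto simp: semigroup_add)
    then show "onorm (T (s + t)) \<le> onorm (T s) * onorm (T t)"
      using onorm_compose semigroup_bounded_linear st by metis
  qed (auto intro: onorm_pos_le semigroup_bounded_linear M)
  then have "growth_bound T = (INF t\<in>{0<..}. ereal_ln (onorm (T t)) / ereal t)"
    unfolding growth_bound_def by (intro tendsto_Lim) auto
  then have "0 \<le> ereal_ln (onorm (T t)) / ereal t"
    using assms INF_lower[of t "{0<..}" "\<lambda>t. ereal_ln (onorm (T t)) / ereal t"] by simp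
  then have "\<not> ereal_ln (onorm (T t)) / ereal t < ereal 0"
    by (simp add: zero_ereal_def)
  then show ?thesis
    using ereal_ln_divide_less_iff[of "onorm (T t)" t 0] assms(3)
      onorm_pos_le[OF semigroup_bounded_linear[of t]] by simp
qed

subsection \<open>Density of the domains of powers of the generator\<close>

lemma generator_eqI:
  assumes "((\<lambda>t. (T t x - x) /\<^sub>R t) \<longlongrightarrow> y) (at_right 0)"
  shows "x \<in> generator_dom T" "generator T x = y"
  using assms tendsto_Lim[OF trivial_limit_at_right_real assms]
  by (auto simp: generator_dom_def generator_def)

lemma generator_tendsto:
  assumes "x \<in> generator_dom T"
  shows "((\<lambda>t. (T t x - x) /\<^sub>R t) \<longlongrightarrow> generator T x) (at_right 0)"
  using assms generator_eqI(2) by (auto simp: generator_dom_def)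

text \<open>\<open>T h\<close> is continuous and commutes with \<open>T t\<close>, so it passes
  through the difference quotient.\<close>

lemma generator_semigroup:
  assumes "x \<in> generator_dom T" "h \<ge> 0"
  shows "T h x \<in> generator_dom T" "generator T (T h x) = T h (generator T x)"
proof -
  interpret Th: bounded_linear "T h"
    using assms semigroup_bounded_linear by blast
  have "((\<lambda>t. T h ((T t x - x) /\<^sub>R t)) \<longlongrightarrow> T h (generator T x)) (at_right 0)"
    by (intro Th.tendsto generator_tendsto assms)
  moreover have "eventually (\<lambda>t. T h ((T t x - x) /\<^sub>R t) = (T t (T h x) - T h x) /\<^sub>R t) (at_right 0)"
    using eventually_at_right_less
  proof eventually_elim
    case (elim t)
    then have "T h (T t x) = T t (T h x)"
      using assms(2) semigroup_add[of h t x] semigroup_add[of t h x] by (simp add: add.commute)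
    then show ?case
      by (simp add: Th.scaleR Th.diff)
  qed
  ultimately have "((\<lambda>t. (T t (T h x) - T h x) /\<^sub>R t) \<longlongrightarrow> T h (generator T x)) (at_right 0)"
    by (simp cong: tendsto_cong)
  then show "T h x \<in> generator_dom T" "generator T (T h x) = T h (generator T x)"
    by (auto intro: generator_eqI)
qed

text \<open>This is the combination occurring in \<open>(T h x - x) /\<^sub>R h\<close>; with
  \<open>y = 0\<close> it also gives scaling.\<close>

lemma generator_diff_scaleR:
  assumes "x \<in> generator_dom T" "y \<in> generator_dom T"
  shows "c *\<^sub>R (x - y) \<in> generator_dom T"
    "generator T (c *\<^sub>R (x - y)) = c *\<^sub>R (generator T x - generator T y)"
proof -
  have "((\<lambda>t. c *\<^sub>R ((T t x - x) /\<^sub>R t - (T t y - y) /\<^sub>R t)) \<longlongrightarrow>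
      c *\<^sub>R (generator T x - generator T y)) (at_right 0)"
    by (intro tendsto_intros generator_tendsto assms)
  moreover have "eventually (\<lambda>t. c *\<^sub>R ((T t x - x) /\<^sub>R t - (T t y - y) /\<^sub>R t) =
      (T t (c *\<^sub>R (x - y)) - c *\<^sub>R (x - y)) /\<^sub>R t) (at_right 0)"
    using eventually_at_right_less
  proof eventually_elim
    case (elim t)
    then interpret Tt: bounded_linear "T t"
      using semigroup_bounded_linear by simp
    show ?case
      by (simp add: Tt.scaleR Tt.diff algebra_simps)
  qed
  ultimately have "((\<lambda>t. (T t (c *\<^sub>R (x - y)) - c *\<^sub>R (x - y)) /\<^sub>R t) \<longlongrightarrow>
      c *\<^sub>R (generator T x - generator T y)) (at_right 0)"
    by (simp cong: tendsto_cong)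
  then show "c *\<^sub>R (x - y) \<in> generator_dom T"
    "generator T (c *\<^sub>R (x - y)) = c *\<^sub>R (generator T x - generator T y)"
    by (auto intro: generator_eqI)
qed

abbreviation (input) "dom_power \<equiv> power_dom (generator_dom T) (generator T)"

lemma dom_power_semigroup: "x \<in> dom_power k \<Longrightarrow> h \<ge> 0 \<Longrightarrow> T h x \<in> dom_power k"
  by (induction k arbitrary: x) (auto simp: generator_semigroup)

lemma dom_power_diff_scaleR:
  "x \<in> dom_power k \<Longrightarrow> y \<in> dom_power k \<Longrightarrow> c *\<^sub>R (x - y) \<in> dom_power k"
  by (induction k arbitrary: x y) (auto simp: generator_diff_scaleR)

section \<open>Averages of orbits\<close>

definition orbit_integral :: "real \<Rightarrow> 'h \<Rightarrow> 'h" where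
  "orbit_integral h x = integral {0..h} (\<lambda>s. T s x)"

lemma orbit_integrable: "0 \<le> a \<Longrightarrow> (\<lambda>s. T s x) integrable_on {a..b}"
  by (intro integrable_continuous_real continuous_on_subset[OF semigroup_continuous]) auto

text \<open>The integral has derivative \<open>T 0 x = x\<close> at \<open>0\<close>, by the
  fundamental theorem of calculus.\<close>

lemma orbit_integral_tendsto: "((\<lambda>h. orbit_integral h x /\<^sub>R h) \<longlongrightarrow> x) (at_right 0)"
proof -
  have "((\<lambda>h. orbit_integral h x) has_vector_derivative T 0 x) (at 0 within {0..1})"
    unfolding orbit_integral_def
    by (intro integral_has_vector_derivative continuous_on_subset[OF semigroup_continuous]) auto
  then have "((\<lambda>h. orbit_integral h x) has_vector_derivative x) (at_right 0)"
    by (simp add: at_within_Icc_at_right semigroup_zero)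
  \<comment> \<open>The derivative says that the remainder divided by \<open>norm h\<close> vanishes
    in the limit. Adding \<open>x\<close> back yields the average, since \<open>norm h = h\<close>
    to the right of \<open>0\<close>.\<close>
  then have "((\<lambda>h. (1 / norm h) *\<^sub>R (orbit_integral h x - h *\<^sub>R x) + x) \<longlongrightarrow> 0 + x) (at_right 0)"
    by (intro tendsto_add tendsto_const)
      (simp add: has_vector_derivative_def has_derivative_within orbit_integral_def)
  moreover have "eventually (\<lambda>h. (1 / norm h) *\<^sub>R (orbit_integral h x - h *\<^sub>R x) + x =
      orbit_integral h x /\<^sub>R h) (at_right 0)"
    using eventually_at_right_less
    by eventually_elim (simp add: algebra_simps divide_inverse)
  ultimately have "((\<lambda>h. orbit_integral h x /\<^sub>R h) \<longlongrightarrow> 0 + x) (at_right 0)"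
    by (rule Lim_transform_eventually)
  then show ?thesis
    by simp
qed

lemma semigroup_orbit_integral:
  assumes "t \<ge> 0" "h \<ge> 0"
  shows "T t (orbit_integral h x) = orbit_integral (t + h) x - orbit_integral t x"
proof -
  have "T t (orbit_integral h x) = integral {0..h} (T t \<circ> (\<lambda>s. T s x))"
    unfolding orbit_integral_def
    by (rule integral_linear[symmetric]) (auto simp: assms orbit_integrable semigroup_bounded_linear)
  also have "\<dots> = integral {0..h} ((\<lambda>s. T s x) \<circ> ((+) t))"
    using assms by (intro integral_cong) (auto simp: semigroup_add)
  also have "\<dots> = integral {t..t + h} (\<lambda>s. T s x)"
    by (simp add: integral_shift_Icc_real add.commute)
  also have "\<dots> = orbit_integral (t + h) x - orbit_integral t x"
    unfolding orbit_integral_def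
    using Henstock_Kurzweil_Integration.integral_combine[of 0 t "t + h" "\<lambda>s. T s x"] assms
    by (simp add: orbit_integrable algebra_simps)
  finally show ?thesis .
qed

text \<open>Writing \<open>I\<close> for the orbit integral of \<open>x\<close>, both
  \<open>T t (I h) - I h\<close> and \<open>T h (I t) - I t\<close> equal
  \<open>I (t + h) - I t - I h\<close>. This symmetry moves the limit
  \<open>t \<rightarrow> 0\<close> onto the averages \<open>I t /\<^sub>R t\<close>, which tend to
  \<open>x\<close>.\<close>

lemma generator_orbit_integral:
  assumes "h \<ge> 0"
  shows "orbit_integral h x \<in> generator_dom T" "generator T (orbit_integral h x) = T h x - x"
proof -
  have "((\<lambda>t. T h (orbit_integral t x /\<^sub>R t) - orbit_integral t x /\<^sub>R t) \<longlongrightarrow> T h x - x) (at_right 0)"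
    by (intro tendsto_diff bounded_linear.tendsto[OF semigroup_bounded_linear]
        orbit_integral_tendsto assms)
  moreover have "eventually (\<lambda>t. T h (orbit_integral t x /\<^sub>R t) - orbit_integral t x /\<^sub>R t =
      (T t (orbit_integral h x) - orbit_integral h x) /\<^sub>R t) (at_right 0)"
    using eventually_at_right_less
  proof eventually_elim
    case (elim t)
    have "T h (orbit_integral t x /\<^sub>R t) = T h (orbit_integral t x) /\<^sub>R t"
      using assms by (intro linear_scale bounded_linear.linear semigroup_bounded_linear)
    then show ?case
      using assms elim by (simp add: semigroup_orbit_integral algebra_simps)
  qed
  ultimately have "((\<lambda>t. (T t (orbit_integral h x) - orbit_integral h x) /\<^sub>R t) \<longlongrightarrow>
      T h x - x) (at_right 0)"
    by (simp cong: tendsto_cong)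
  then show "orbit_integral h x \<in> generator_dom T" "generator T (orbit_integral h x) = T h x - x"
    by (auto intro: generator_eqI)
qed

text \<open>The generator sends the average to \<open>(T h x - x) /\<^sub>R h\<close>, which remains
  in the domain of the \<open>k\<close>-th power because \<open>T h\<close> preserves that
  domain.\<close>

lemma orbit_integral_dom_power:
  assumes "x \<in> dom_power k" "h \<ge> 0"
  shows "orbit_integral h x /\<^sub>R h \<in> dom_power (Suc k)"
proof -
  \<comment> \<open>The integral over a degenerate interval supplies \<open>0\<close> as a domain
    element with image \<open>0\<close>, so that scaling by \<open>inverse h\<close> is the case
    \<open>y = 0\<close> of the difference rule.\<close>
  have "orbit_integral 0 x = 0"
    by (simp add: orbit_integral_def)
  then have "0 \<in> generator_dom T" "generator T 0 = 0"
    using generator_orbit_integral[of 0 x] by (simp_all add: semigroup_zero)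
  then show ?thesis
    using assms generator_diff_scaleR[of "orbit_integral h x" 0 "inverse h"]
      dom_power_diff_scaleR[OF dom_power_semigroup[OF assms] assms(1), of "inverse h"]
    by (simp add: generator_orbit_integral semigroup_zero)
qed

text \<open>Each element of one domain is the limit of its averages, which lie in the next domain;
  density is thus inherited by induction.\<close>

lemma closure_dom_power: "closure (dom_power k) = UNIV"
proof (induction k)
  case (Suc k)
  have "x \<in> closure (dom_power (Suc k))" if "x \<in> dom_power k" for x
  proof (rule Lim_in_closed_set[OF closed_closure _ _ orbit_integral_tendsto])
    show "eventually (\<lambda>h. orbit_integral h x /\<^sub>R h \<in> closure (dom_power (Suc k))) (at_right 0)"
      using eventually_at_right_less
    proof eventually_elim
      case (elim h)
      then show ?case
        using orbit_integral_dom_power[OF that, of h] by (intro subsetD[OF closure_subset]) simp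
    qed
  qed simp
  then show ?case
    using Suc closure_minimal[of "dom_power k" "closure (dom_power (Suc k))"] by blast
qed simp

end

subsection \<open>Dense open sets of orbits\<close>

lemma less_onormD:
  assumes "0 \<le> c" "c < onorm f"
  obtains x where "c * norm x < norm (f x)"
  using onorm_bound[of c f] assms by (meson not_le)

text \<open>
  One of the perturbations \<open>x + y\<close> and \<open>x - y\<close> has an image at least as large as that of \<open>y\<close>,
  since \<open>2 y = (x + y) - (x - y)\<close>.
\<close>

lemma closure_large_image:
  fixes S :: "real \<Rightarrow> 'a::real_normed_vector \<Rightarrow> 'b::real_normed_vector"
  assumes lin: "\<And>t. t \<in> I \<Longrightarrow> bounded_linear (S t)"
    and pos: "\<And>t. t \<in> I \<Longrightarrow> \<alpha> t > 0"
    and unbounded: "\<And>c. \<exists>t\<in>I. c < \<alpha> t * onorm (S t)"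
  shows "closure (\<Union>t\<in>I. {x. c < \<alpha> t * norm (S t x)}) = UNIV"
proof -
  have "\<exists>z\<in>\<Union>t\<in>I. {x. c < \<alpha> t * norm (S t x)}. dist z x < e" if e: "e > 0" for x e
  proof -
    \<comment> \<open>The threshold is chosen so that a vector of norm \<open>e / 2\<close> has an
      image of norm above \<open>\<bar>c\<bar> / \<alpha> t\<close>. The absolute value makes the
      bound nonnegative, as \<open>less_onormD\<close> requires.\<close>
    obtain t where t: "t \<in> I" "2 * \<bar>c\<bar> / e < \<alpha> t * onorm (S t)"
      using unbounded by blast
    interpret St: bounded_linear "S t"
      using lin t by blast
    have a: "\<alpha> t > 0"
      using pos t by blast
    have "2 * \<bar>c\<bar> / e / \<alpha> t < onorm (S t)"
      using t a by (subst pos_divide_less_eq) (simp_all only: mult.commute)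
    then obtain w where w: "2 * \<bar>c\<bar> / e / \<alpha> t * norm w < norm (S t w)"
      using less_onormD[of "2 * \<bar>c\<bar> / e / \<alpha> t" "S t"] e a by auto
    then have "w \<noteq> 0"
      by (auto simp: St.zero)
    define y where "y = (e / (2 * norm w)) *\<^sub>R w"
    have y: "norm y = e / 2"
      using e \<open>w \<noteq> 0\<close> by (simp add: y_def)
    have "\<bar>c\<bar> / \<alpha> t < norm (S t y)"
      using w e a \<open>w \<noteq> 0\<close> by (simp add: y_def St.scaleR field_simps)
    moreover have "2 * norm (S t y) \<le> norm (S t (x + y)) + norm (S t (x - y))"
    proof -
      have "2 *\<^sub>R S t y = S t (x + y) - S t (x - y)"
        by (simp add: St.add St.diff scaleR_2)
      then have "norm (2 *\<^sub>R S t y) \<le> norm (S t (x + y)) + norm (S t (x - y))"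
        by (metis norm_triangle_ineq4)
      then show ?thesis
        by simp
    qed
    ultimately have "\<bar>c\<bar> / \<alpha> t < norm (S t (x + y)) \<or> \<bar>c\<bar> / \<alpha> t < norm (S t (x - y))"
      by linarith
    then have "\<bar>c\<bar> < \<alpha> t * norm (S t (x + y)) \<or> \<bar>c\<bar> < \<alpha> t * norm (S t (x - y))"
      using a by (simp add: pos_divide_less_eq mult.commute)
    then have "c < \<alpha> t * norm (S t (x + y)) \<or> c < \<alpha> t * norm (S t (x - y))"
      by linarith
    moreover have "dist (x + y) x < e" "dist (x - y) x < e"
      using y e by (simp_all add: dist_norm)
    ultimately show ?thesis
      using t(1) by blast
  qed
  then show ?thesis
    by (auto simp: closure_approachable)
qed

section \<open>The Baire argument for orbits of the semigroup\<close>

theorem theorem1p4: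
  fixes T :: "real \<Rightarrow> 'h::complex_hilbert_space \<Rightarrow> 'h"
    and k :: nat
    and r \<alpha> \<beta> :: "real \<Rightarrow> real"
  defines "A \<equiv> generator T" and "D \<equiv> generator_dom T"
  assumes "C0_semigroup T"
    and "bounded_semigroup T"
    and "growth_bound T = 0"
    and "inj_on A D"
    and "k \<ge> 1"
    and "\<forall>t\<ge>0. r t \<ge> 0"
    and "(r \<longlongrightarrow> 0) at_top"
    and "\<exists>C>0. \<exists>t0>0. \<forall>t\<ge>t0. \<forall>x\<in>power_dom D A k.
           norm (T t x) \<le> C * r t * norm ((A ^^ k) x)"
    and "\<forall>t\<ge>0. \<alpha> t > 0"
    and "\<forall>t\<ge>0. \<beta> t > 0"
    and "filterlim \<alpha> at_top at_top"
    and "Liminf at_top (\<lambda>t. ereal (\<beta> t * r t)) = 0"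
  shows "closure (\<G> T \<alpha> \<beta>) = UNIV \<and> gdelta (\<G> T \<alpha> \<beta>)"
proof -
  note T = assms(3)
  have \<alpha>: "\<And>t. t \<ge> 0 \<Longrightarrow> \<alpha> t > 0" and \<beta>: "\<And>t. t \<ge> 0 \<Longrightarrow> \<beta> t > 0"
    and r: "\<And>t. t \<ge> 0 \<Longrightarrow> r t \<ge> 0"
    using assms by auto
  define U where "U n = (\<Union>t\<in>{real n..}. {x. real n < \<alpha> t * norm (T t x)})" for n
  define V where "V n = (\<Union>t\<in>{real n..}. {x. \<beta> t * norm (T t x) < 1 / (real n + 1)})" for n
  have eq: "\<G> T \<alpha> \<beta> = (\<Inter>n. U n \<inter> V n)"
    using \<beta> by (auto simp: \<G>_def U_def V_def Limsup_at_top_eq_PInfty_iff less_imp_le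
        Liminf_at_top_eq_0_iff)
  have cont: "continuous_on UNIV (T t)" if "t \<ge> 0" for t
    using semigroup_bounded_linear[OF T that] by (simp add: linear_continuous_on)
  have openU: "open (U n)" for n
    unfolding U_def
    by (intro open_UN ballI open_Collect_less continuous_intros cont) auto
  have openV: "open (V n)" for n
    unfolding V_def
    by (intro open_UN ballI open_Collect_less continuous_intros cont) auto
  have denseU: "closure (U n) = UNIV" for n
    unfolding U_def
  proof (rule closure_large_image)
    fix c
    \<comment> \<open>Since \<open>onorm (T t) \<ge> 1\<close> for \<open>t > 0\<close>, it suffices
      that \<open>\<alpha> t\<close> itself exceeds \<open>c\<close>; the maximum with
      \<open>0\<close> makes \<open>\<alpha> t\<close> a positive factor.\<close>
    have "eventually (\<lambda>t. max c 0 < \<alpha> t \<and> t \<ge> real n \<and> t > 0) at_top"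
      using assms(13) unfolding filterlim_at_top_dense
      by (intro eventually_conj eventually_ge_at_top eventually_gt_at_top) blast
    then obtain t where t: "max c 0 < \<alpha> t" "t \<ge> real n" "t > 0"
      using eventually_happens'[OF trivial_limit_at_top_linorder] by force
    have "\<alpha> t * 1 \<le> \<alpha> t * onorm (T t)"
      using t onorm_semigroup_ge_1[OF T assms(4,5) t(3)] by (intro mult_left_mono) auto
    then have "c < \<alpha> t * onorm (T t)"
      using t(1) by linarith
    with t show "\<exists>t\<in>{real n..}. c < \<alpha> t * onorm (T t)"
      by (intro bexI[of _ t]) simp_all
  qed (use \<alpha> semigroup_bounded_linear[OF T] in auto)
  have domV: "power_dom D A k \<subseteq> V n" for n
  proof
    fix x assume x: "x \<in> power_dom D A k"
    obtain C t0 where C: "C > 0" "t0 > 0"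
      "\<And>t. t \<ge> t0 \<Longrightarrow> norm (T t x) \<le> C * r t * norm ((A ^^ k) x)"
      using assms(10) x by blast
    define c where "c = C * norm ((A ^^ k) x)"
    have c: "c \<ge> 0"
      using C by (simp add: c_def)
    \<comment> \<open>Times beyond \<open>m\<close> exceed both \<open>n\<close> and
      \<open>t0\<close>, and \<open>c * (n + 1) \<le> m\<close> ensures
      \<open>c / (m + 1) < 1 / (n + 1)\<close>, which absorbs the constant \<open>c\<close>
      depending on \<open>x\<close>.\<close>
    obtain m where m: "real m \<ge> max (real n) (max t0 (c * (real n + 1)))"
      using real_arch_simple by blast
    have "\<forall>n. \<exists>t\<ge>real n. \<beta> t * r t < 1 / (real n + 1)"
      using assms(14) \<beta> r by (subst Liminf_at_top_eq_0_iff[symmetric]) (auto simp: less_imp_le)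
    then obtain t where t: "t \<ge> real m" "\<beta> t * r t < 1 / (real m + 1)"
      by blast
    have t0: "t \<ge> t0" "t \<ge> real n" "t \<ge> 0"
      using t m by auto
    have "\<beta> t * norm (T t x) \<le> \<beta> t * (C * r t * norm ((A ^^ k) x))"
      using C(3)[of t] \<beta>[of t] t0 by (intro mult_left_mono) auto
    also have "\<dots> = c * (\<beta> t * r t)"
      by (simp add: c_def)
    also have "\<dots> \<le> c * (1 / (real m + 1))"
      using c t by (intro mult_left_mono) auto
    also have "\<dots> < 1 / (real n + 1)"
      using m by (simp add: field_simps)
    finally show "x \<in> V n"
      using t0 by (auto simp: V_def)
  qed
  have denseV: "closure (V n) = UNIV" for n
    using closure_mono[OF domV[of n]] closure_dom_power[OF T, of k]
    by (auto simp: A_def D_def)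
  \<comment> \<open>As \<open>U n\<close> is open and \<open>V n\<close> is dense,
    \<open>U n\<close> lies in the closure of the intersection; density of \<open>U n\<close> then
    makes this closure the whole space.\<close>
  have "closure (U n \<inter> V n) = UNIV" for n
    using closure_minimal[OF open_Int_closure_subset[OF openU, of n "V n"]] denseU denseV by auto
  then have "closure (\<G> T \<alpha> \<beta>) = UNIV"
    unfolding eq using openU openV by (intro complete_space_Baire) auto
  moreover have "gdelta (\<G> T \<alpha> \<beta>)"
    unfolding eq using openU openV by (intro gdelta.intros) auto
  ultimately show ?thesis ..
qed

end
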